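(* Let $B$ be a left semi-brace. Then the skew left brace $G$ has finite multipermutational level and $E$ is an ideal of $B$ if and only if $B$ is right nilpotent and $(G,+)$ is a nilpotent group.
   Context: A left semi-brace is a set $B$ with two operations $+$ and $\circ$ such that $(B,+)$ is a left cancellative semigroup (not necessarily commutative), $(B,\circ)$ is a group, and $a\circ(b+c)=a\circ b+a\circ(a^-+c)$ for all $a,b,c\in B$, where $a^-$ is the inverse of $a$ in $(B,\circ)$ and $\circ$ has higher precedence than $+$. A skew left brace is a left semi-brace whose additive semigroup is a group. The identity of $(B,\circ)$ is denoted $0$; it is an idempotent and a left identity of $(B,+)$. Let $E$ be the set of idempotents of $(B,+)$ and $G=B+0=\{b+0: b\in B\}$, which is a subgroup of $(B,+)$ (with identity $0$) and a skew left brace under $+$ and $\circ$. For $a,b\in B$ put $\lambda_a(b)=a\circ(a^-+b)$, $\rho_b(a)=(a^-+b)^-\circ b$, and define the operation $a\cdot b=\lambda_a(a^-)+a\circ b+\lambda_b(b^-)$; one has $a\cdot b\in G$. For subsets $X,Y\subseteq B$, $X\cdot Y$ denotes the subgroup of $(G,+)$ generated by all $x\cdot y$ with $x\in X$, $y\in Y$, and $X+Y=\{x+y:x\in X,y\in Y\}$. A subsemigroup $I$ of $(B,+)$ is an ideal of $B$ if: (i) $I$ is a normal subgroup of $(B,\circ)$; (ii) $I\cap G$ is a normal subgroup of $(G,+)$; (iii) $\rho_b(n)\in I$ for all $b\in B$, $n\in I\cap G$; (iv) $\lambda_g(e)\in I$ for all $g\in G$, $e\in I\cap E$. For an ideal $I$,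 $B/I$ is the quotient group $(B,\circ)/I$ with the induced addition (which is well defined); it is a left semi-brace. The socle of a left semi-brace $B$ is the ideal $\operatorname{Soc}(B)=\{a\in B:\rho_a=\rho_0,\ \lambda_a=\lambda_0\}$. For a skew left brace $A$ this is $\{a\in A: a+b=a\circ b \text{ and } a+b=b+a \text{ for all } b\in A\}$. A skew left brace $A$ has finite multipermutational level if the sequence of skew left braces $S_1=A$, $S_{n+1}=S_n/\operatorname{Soc}(S_n)$ for $n\ge1$ reaches the zero (one-element) skew left brace. The right series of $B$ is $B^{(1)}=B$, $B^{(n+1)}=B^{(n)}\cdot B+E$ for $n\ge 1$; $B$ is right nilpotent if $B^{(n)}=E$ for some positive integer $n$. *)

theory Defs
  imports "HOL-Algebra.Generated_Groups"
begin

text \<open>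
  The \<^emph>\<open>multiplicative\<close> part of the record carries the operation \<open>\<circ>\<close>, so a
  semi-brace is itself usable as the group \<open>(B, \<circ>)\<close>: \<open>\<one>\<close> is the element that is
  usually written \<open>0\<close>, and \<open>inv a\<close> is \<open>a\<^sup>-\<close>. The field \<open>plus\<close> is the operation \<open>+\<close>.
\<close>

record 'a semi_brace = "'a monoid" +
  plus :: "'a \<Rightarrow> 'a \<Rightarrow> 'a"  (infixl "\<boxplus>\<index>" 65)

locale left_semi_brace = group B for B :: "'a semi_brace" (structure) +
  assumes plus_closed: "\<lbrakk>a \<in> carrier B; b \<in> carrier B\<rbrakk> \<Longrightarrow> a \<boxplus> b \<in> carrier B"
    and plus_assoc: "\<lbrakk>a \<in> carrier B; b \<in> carrier B; c \<in> carrier B\<rbrakk>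
      \<Longrightarrow> (a \<boxplus> b) \<boxplus> c = a \<boxplus> (b \<boxplus> c)"
    and plus_left_cancel: "\<lbrakk>a \<in> carrier B; b \<in> carrier B; c \<in> carrier B; a \<boxplus> b = a \<boxplus> c\<rbrakk>
      \<Longrightarrow> b = c"
    and mult_plus: "\<lbrakk>a \<in> carrier B; b \<in> carrier B; c \<in> carrier B\<rbrakk>
      \<Longrightarrow> a \<otimes> (b \<boxplus> c) = (a \<otimes> b) \<boxplus> (a \<otimes> (inv a \<boxplus> c))"

text \<open>
  The additive structure. Its unit field is only meaningful when the additive semigroup is a
  group, in which case the two identity elements coincide: \<open>\<one>\<close> is always an additive idempotent.
\<close>

definition additive :: "'a semi_brace \<Rightarrow> 'a monoid" where
  "additive B = \<lparr>carrier = carrier B, mult = plus B, one = \<one>\<^bsub>B\<^esub>\<rparr>"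

definition skew_left_brace :: "'a semi_brace \<Rightarrow> bool" where
  "skew_left_brace B \<longleftrightarrow> left_semi_brace B \<and> group (additive B)"

definition plus_idempotents :: "'a semi_brace \<Rightarrow> 'a set" where
  "plus_idempotents B = {e \<in> carrier B. e \<boxplus>\<^bsub>B\<^esub> e = e}"

definition brace_part :: "'a semi_brace \<Rightarrow> 'a semi_brace" where
  "brace_part B = B\<lparr>carrier := {b \<boxplus>\<^bsub>B\<^esub> \<one>\<^bsub>B\<^esub> | b. b \<in> carrier B}\<rparr>"

definition lam :: "'a semi_brace \<Rightarrow> 'a \<Rightarrow> 'a \<Rightarrow> 'a" where
  "lam B a b = a \<otimes>\<^bsub>B\<^esub> (inv\<^bsub>B\<^esub> a \<boxplus>\<^bsub>B\<^esub> b)"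

text \<open>Argument order: \<open>rho B b a\<close> is \<open>\<rho>\<^sub>b(a)\<close>.\<close>

definition rho :: "'a semi_brace \<Rightarrow> 'a \<Rightarrow> 'a \<Rightarrow> 'a" where
  "rho B b a = inv\<^bsub>B\<^esub> (inv\<^bsub>B\<^esub> a \<boxplus>\<^bsub>B\<^esub> b) \<otimes>\<^bsub>B\<^esub> b"

definition dot :: "'a semi_brace \<Rightarrow> 'a \<Rightarrow> 'a \<Rightarrow> 'a" where
  "dot B a b = lam B a (inv\<^bsub>B\<^esub> a) \<boxplus>\<^bsub>B\<^esub> (a \<otimes>\<^bsub>B\<^esub> b) \<boxplus>\<^bsub>B\<^esub> lam B b (inv\<^bsub>B\<^esub> b)"

definition dot_set :: "'a semi_brace \<Rightarrow> 'a set \<Rightarrow> 'a set \<Rightarrow> 'a set" where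
  "dot_set B X Y = generate (additive (brace_part B)) {dot B x y | x y. x \<in> X \<and> y \<in> Y}"

definition plus_set :: "'a semi_brace \<Rightarrow> 'a set \<Rightarrow> 'a set \<Rightarrow> 'a set" where
  "plus_set B X Y = {x \<boxplus>\<^bsub>B\<^esub> y | x y. x \<in> X \<and> y \<in> Y}"

definition semi_brace_ideal :: "'a set \<Rightarrow> 'a semi_brace \<Rightarrow> bool" where
  "semi_brace_ideal I B \<longleftrightarrow>
     I \<subseteq> carrier B \<and> (\<forall>x\<in>I. \<forall>y\<in>I. x \<boxplus>\<^bsub>B\<^esub> y \<in> I) \<and>
     I \<lhd> B \<and>
     (I \<inter> carrier (brace_part B)) \<lhd> additive (brace_part B) \<and>
     (\<forall>b\<in>carrier B. \<forall>n\<in>I \<inter> carrier (brace_part B). rho B b n \<in> I) \<and>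
     (\<forall>g\<in>carrier (brace_part B). \<forall>e\<in>I \<inter> plus_idempotents B. lam B g e \<in> I)"

text \<open>
  The induced addition sends two cosets to the union of the cosets of all sums of representatives;
  this is a single coset when \<open>I\<close> is an ideal. It is not defined as a plain set of sums because in
  a semi-brace such a set need not be a full coset.
\<close>

definition quotient_semi_brace :: "'a semi_brace \<Rightarrow> 'a set \<Rightarrow> 'a set semi_brace" where
  "quotient_semi_brace B I =
     \<lparr>carrier = carrier (B Mod I), mult = mult (B Mod I), one = one (B Mod I),
      plus = (\<lambda>X Y. \<Union>x\<in>X. \<Union>y\<in>Y. I #>\<^bsub>B\<^esub> (x \<boxplus>\<^bsub>B\<^esub> y))\<rparr>"

definition socle :: "'a semi_brace \<Rightarrow> 'a set" where
  "socle B = {a \<in> carrier B. \<forall>b\<in>carrier B.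
     rho B a b = rho B \<one>\<^bsub>B\<^esub> b \<and> lam B a b = lam B \<one>\<^bsub>B\<^esub> b}"

definition semi_brace_isomorphic :: "'a semi_brace \<Rightarrow> 'b semi_brace \<Rightarrow> bool" where
  "semi_brace_isomorphic A B \<longleftrightarrow> (\<exists>f. f \<in> iso A B \<and> f \<in> iso (additive A) (additive B))"

text \<open>
  The literal sequence \<open>S\<^sub>1 = A\<close>, \<open>S\<^sub>n\<^sub>+\<^sub>1 = S\<^sub>n / Soc(S\<^sub>n)\<close> changes its element type at every step
  (sets, sets of sets, ...). Each term is therefore taken up to isomorphism, as a structure on the
  type of \<open>A\<close>: every quotient has a copy on a set of coset representatives, and the sequence is
  determined by \<open>A\<close> up to isomorphism, so it does not matter which copies are chosen.
\<close>

definition finite_multipermutational_level :: "'a semi_brace \<Rightarrow> bool" where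
  "finite_multipermutational_level A \<longleftrightarrow>
     (\<exists>S :: nat \<Rightarrow> 'a semi_brace.
        S 1 = A \<and>
        (\<forall>n\<ge>1. skew_left_brace (S n) \<and>
           semi_brace_isomorphic (S (Suc n)) (quotient_semi_brace (S n) (socle (S n)))) \<and>
        (\<exists>n\<ge>1. carrier (S n) = {\<one>\<^bsub>S n\<^esub>}))"

text \<open>Indexing from zero: \<open>right_series B n\<close> is \<open>B\<^sup>(\<^sup>n\<^sup>+\<^sup>1\<^sup>)\<close>.\<close>

primrec right_series :: "'a semi_brace \<Rightarrow> nat \<Rightarrow> 'a set" where
  "right_series B 0 = carrier B"
| "right_series B (Suc n) =
     plus_set B (dot_set B (right_series B n) (carrier B)) (plus_idempotents B)"

definition right_nilpotent :: "'a semi_brace \<Rightarrow> bool" where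
  "right_nilpotent B \<longleftrightarrow> (\<exists>n. right_series B n = plus_idempotents B)"

primrec lower_central_series :: "'a monoid \<Rightarrow> nat \<Rightarrow> 'a set" where
  "lower_central_series G 0 = carrier G"
| "lower_central_series G (Suc n) =
     generate G {h \<otimes>\<^bsub>G\<^esub> g \<otimes>\<^bsub>G\<^esub> inv\<^bsub>G\<^esub> h \<otimes>\<^bsub>G\<^esub> inv\<^bsub>G\<^esub> g | h g.
       h \<in> lower_central_series G n \<and> g \<in> carrier G}"

definition nilpotent_group :: "'a monoid \<Rightarrow> bool" where
  "nilpotent_group G \<longleftrightarrow> group G \<and> (\<exists>n. lower_central_series G n = {\<one>\<^bsub>G\<^esub>})"

end

theory Submission
  imports Defs
begin

text \<open>
  Write \<open>a\<close>, \<open>b\<close> for elements of \<open>B\<close>, \<open>g\<close>, \<open>h\<close> for elements of \<open>G\<close> and \<open>e\<close>, \<open>f\<close> for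
  idempotents. Every element of \<open>B\<close> has the form \<open>g + e\<close>, every \<open>e\<close> is a left identity of the
  addition, and \<open>a \<cdot> b = -a + a \<circ> b - b\<close>, where \<open>-a \<in> G\<close> is the right inverse of \<open>a\<close>.

  The idempotents form a subgroup of \<open>(B, \<circ>)\<close>, and \<open>E\<close> is an ideal if and only if this subgroup
  is normal (\<open>idempotents_ideal_iff\<close>). If it is, then \<open>(g + e) \<cdot> (h + f) = g \<cdot> h\<close>, so the terms
  of the right series of \<open>B\<close> are those of \<open>G\<close> plus \<open>E\<close>, and \<open>B\<close> is right nilpotent exactly when
  \<open>G\<close> is (\<open>right_nilpotent_iff_brace_part\<close>). Conversely, the right series is decreasing, so if
  it reaches \<open>E\<close> then \<open>e \<cdot> h\<close> is in \<open>G \<inter> E\<close>, that is \<open>e \<cdot> h = 0\<close>; hence \<open>e \<circ> h + 0 = h\<close>, which says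
  that \<open>h\<^sup>- \<circ> e \<circ> h\<close> is in \<open>E\<close>, and \<open>E\<close> is normal (\<open>right_nilpotent_imp_normal\<close>).

  It remains to show that a skew left brace \<open>A\<close> has finite multipermutational level if and only
  if it is right nilpotent and \<open>(A, +)\<close> is nilpotent. Let \<open>Z\<^sub>k\<close> be the kernel of the map from \<open>A\<close>
  to the \<open>k\<close>-th iterated quotient by the socle. Then \<open>a \<in> Z\<^sub>k\<^sub>+\<^sub>1\<close> if and only if \<open>\<lambda>\<^sub>a(b) - b\<close> and
  the additive commutator of \<open>a\<close> and \<open>b\<close> lie in \<open>Z\<^sub>k\<close> for all \<open>b\<close>, and finite level means that
  some \<open>Z\<^sub>k\<close> is all of \<open>A\<close> (\<open>finite_multipermutational_level_iff\<close>). In that case the \<open>j\<close>-th terms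
  of the right series and of the lower central series, counted from zero, lie in \<open>Z\<^sub>k\<^sub>-\<^sub>j\<close>.
  Conversely, let \<open>R\<^sub>m\<close> and \<open>\<gamma>\<^sub>j\<close> be the terms of the right series and of the lower central
  series. The \<open>R\<^sub>m\<close> are normal in \<open>(A, +)\<close>, so \<open>R\<^sub>m\<^sub>+\<^sub>1 \<subseteq> Z\<^sub>k\<close> and \<open>\<gamma>\<^sub>c = 0\<close> give
  \<open>R\<^sub>m \<inter> \<gamma>\<^sub>c\<^sub>-\<^sub>j \<subseteq> Z\<^sub>k\<^sub>+\<^sub>j\<close> by induction on \<open>j\<close>
  (\<open>right_series_inter_lower_central_series\<close>); for \<open>j = c\<close> this is \<open>R\<^sub>m \<subseteq> Z\<^sub>k\<^sub>+\<^sub>c\<close>.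
\<close>

section \<open>The additive structure of a left semi-brace\<close>

lemma additive_simps [simp]:
  "carrier (additive B) = carrier B" "mult (additive B) = plus B" "one (additive B) = one B"
  by (simp_all add: additive_def)

lemma brace_part_simps [simp]:
  "mult (brace_part B) = mult B" "one (brace_part B) = one B" "plus (brace_part B) = plus B"
  by (simp_all add: brace_part_def)

lemma brace_part_eq: "brace_part B = B\<lparr>carrier := carrier (brace_part B)\<rparr>"
  by (simp add: brace_part_def)

text \<open>
  The element \<open>\<lambda>\<^sub>a(a\<^sup>-)\<close>: it is the unique right inverse of \<open>a\<close> with respect to \<open>+\<close> and \<open>\<one>\<close>, and
  the additive inverse of \<open>a\<close> when \<open>a\<close> lies in the skew left brace of \<open>B\<close>.
\<close>

definition plus_neg :: "'a semi_brace \<Rightarrow> 'a \<Rightarrow> 'a" where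
  "plus_neg B a = lam B a (inv\<^bsub>B\<^esub> a)"

lemma dot_plus_neg:
  "dot B a b = plus_neg B a \<boxplus>\<^bsub>B\<^esub> (a \<otimes>\<^bsub>B\<^esub> b) \<boxplus>\<^bsub>B\<^esub> plus_neg B b"
  by (simp add: dot_def plus_neg_def)

context left_semi_brace
begin

text \<open>The skew left brace inside \<open>B\<close> and the additive idempotents.\<close>

abbreviation G where "G \<equiv> carrier (brace_part B)"
abbreviation E where "E \<equiv> plus_idempotents B"

lemmas [simp] = plus_closed

lemma one_plus [simp]:
  assumes "a \<in> carrier B" shows "\<one> \<boxplus> a = a"
proof -
  have "\<one> \<boxplus> a = \<one> \<boxplus> (\<one> \<boxplus> a)"
    using mult_plus[of \<one> \<one> a] assms by simp
  then show ?thesis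
    using plus_left_cancel[of \<one> a "\<one> \<boxplus> a"] assms by simp
qed

lemma lam_closed [simp]:
  "\<lbrakk>a \<in> carrier B; b \<in> carrier B\<rbrakk> \<Longrightarrow> lam B a b \<in> carrier B"
  by (simp add: lam_def)

lemma mult_eq_plus_lam:
  assumes "a \<in> carrier B" "b \<in> carrier B"
  shows "a \<otimes> b = a \<boxplus> lam B a b"
  using mult_plus[of a \<one> b] assms by (simp add: lam_def)

lemma plus_eq_mult_lam:
  assumes "a \<in> carrier B" "b \<in> carrier B"
  shows "a \<boxplus> b = a \<otimes> lam B (inv a) b"
  using assms by (simp add: lam_def m_assoc[symmetric])

lemma lam_one [simp]:
  "b \<in> carrier B \<Longrightarrow> lam B \<one> b = b"
  by (simp add: lam_def)

lemma lam_plus: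
  assumes "a \<in> carrier B" "b \<in> carrier B" "c \<in> carrier B"
  shows "lam B a (b \<boxplus> c) = lam B a b \<boxplus> lam B a c"
  using mult_plus[of a "inv a \<boxplus> b" c] assms by (simp add: lam_def plus_assoc)

lemma plus_neg_closed [simp]: "a \<in> carrier B \<Longrightarrow> plus_neg B a \<in> carrier B"
  by (simp add: plus_neg_def)

lemma plus_plus_neg [simp]:
  "a \<in> carrier B \<Longrightarrow> a \<boxplus> plus_neg B a = \<one>"
  using mult_eq_plus_lam[of a "inv a"] by (simp add: plus_neg_def)

text \<open>The additive idempotents are exactly the left identities of the addition.\<close>

lemma idempotent_carrier [simp]: "e \<in> E \<Longrightarrow> e \<in> carrier B"
  by (simp add: plus_idempotents_def)

lemma idempotent_plus [simp]:
  assumes "e \<in> E" "b \<in> carrier B" shows "e \<boxplus> b = b"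
proof (rule plus_left_cancel)
  have "e \<boxplus> e = e"
    using assms unfolding plus_idempotents_def by blast
  then show "e \<boxplus> (e \<boxplus> b) = e \<boxplus> b"
    using assms by (simp flip: plus_assoc)
qed (use assms in auto)

lemma idempotentI: "\<lbrakk>e \<in> carrier B; e \<boxplus> e = e\<rbrakk> \<Longrightarrow> e \<in> E"
  unfolding plus_idempotents_def by blast

lemma one_idempotent [simp]: "\<one> \<in> E"
  by (rule idempotentI) simp_all

lemma lam_idempotent [simp]:
  assumes "a \<in> carrier B" "e \<in> E" shows "lam B a e \<in> E"
  using assms by (intro idempotentI) (simp_all flip: lam_plus)

lemma plus_idempotent_plus:
  assumes "a \<in> carrier B" "e \<in> E" "b \<in> carrier B"
  shows "(a \<boxplus> e) \<boxplus> b = a \<boxplus> b"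
  using assms by (simp add: plus_assoc)

lemma inv_idempotent [simp]:
  assumes "e \<in> E" shows "inv e \<in> E"
proof -
  have "inv e = lam B (inv e) \<one>"
    using assms by (simp add: lam_def)
  then show ?thesis
    using assms lam_idempotent[of "inv e" \<one>] by simp
qed

text \<open>On idempotents the two operations are linked by \<open>e \<circ> b = \<lambda>\<^sub>e(b)\<close>.\<close>

lemma lam_by_idempotent:
  assumes "e \<in> E" "b \<in> carrier B" shows "lam B e b = e \<otimes> b"
  using assms by (simp add: lam_def)

lemma idempotents_subgroup: "subgroup E B"
proof (rule subgroupI)
  show "a \<otimes> b \<in> E" if "a \<in> E" "b \<in> E" for a b
    using that lam_by_idempotent[of a b] lam_idempotent[of a b] by simp
  show "E \<noteq> {}"
    using one_idempotent by blast
qed auto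

lemma plus_neg_unique:
  assumes "a \<in> carrier B" "b \<in> carrier B" "a \<boxplus> b = \<one>"
  shows "b = plus_neg B a"
  using plus_left_cancel[of a b "plus_neg B a"] assms by simp

lemma plus_neg_plus_idempotent:
  assumes "a \<in> carrier B" "e \<in> E" shows "plus_neg B (a \<boxplus> e) = plus_neg B a"
proof (rule plus_neg_unique)
  show "a \<boxplus> plus_neg B (a \<boxplus> e) = \<one>"
    using assms plus_idempotent_plus[of a e "plus_neg B (a \<boxplus> e)"] by simp
qed (use assms in auto)

text \<open>An element lies in \<open>G\<close> exactly when \<open>\<one>\<close> is a right identity for it.\<close>

lemma mem_G_iff: "b \<in> G \<longleftrightarrow> b \<in> carrier B \<and> b \<boxplus> \<one> = b"
proof
  assume "b \<in> G"
  then show "b \<in> carrier B \<and> b \<boxplus> \<one> = b"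
    by (auto simp: brace_part_def plus_assoc)
next
  assume "b \<in> carrier B \<and> b \<boxplus> \<one> = b"
  then have "\<exists>c. b = c \<boxplus> \<one> \<and> c \<in> carrier B"
    by metis
  then show "b \<in> G"
    by (simp add: brace_part_def)
qed

lemma GI: "\<lbrakk>b \<in> carrier B; b \<boxplus> \<one> = b\<rbrakk> \<Longrightarrow> b \<in> G"
  using mem_G_iff by blast

lemma G_carrier [simp]: "g \<in> G \<Longrightarrow> g \<in> carrier B"
  using mem_G_iff by blast

lemma G_plus_one [simp]: "g \<in> G \<Longrightarrow> g \<boxplus> \<one> = g"
  using mem_G_iff by blast

lemma one_G [simp]: "\<one> \<in> G"
  by (rule GI) simp_all

lemma lam_G_one:
  assumes "g \<in> G" shows "lam B g \<one> = \<one>"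
proof (rule plus_left_cancel)
  show "g \<boxplus> lam B g \<one> = g \<boxplus> \<one>"
    using assms mult_eq_plus_lam[of g \<one>] by simp
qed (use assms in auto)

lemma plus_neg_G [simp]:
  assumes "a \<in> carrier B" shows "plus_neg B a \<in> G"
proof -
  have "plus_neg B a \<boxplus> \<one> = plus_neg B a"
    using assms by (intro plus_neg_unique) (auto simp: plus_assoc[symmetric])
  then show ?thesis
    using assms by (intro GI) simp_all
qed

lemma plus_neg_plus [simp]:
  assumes "g \<in> G" shows "plus_neg B g \<boxplus> g = \<one>"
proof -
  let ?n = "plus_neg B g"
  have "g = (g \<boxplus> ?n) \<boxplus> plus_neg B ?n"
    using assms plus_assoc[of g ?n "plus_neg B ?n"] by simp
  then have "plus_neg B ?n = g"
    using assms by simp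
  then show ?thesis
    using assms plus_plus_neg[of ?n] by simp
qed

lemma G_subgroup: "subgroup G B"
proof (rule subgroupI)
  show "inv a \<in> G" if "a \<in> G" for a
  proof -
    have "a \<otimes> (inv a \<boxplus> \<one>) = \<one>"
      using lam_G_one[OF that] by (simp add: lam_def)
    then have "inv a \<boxplus> \<one> = inv a"
      using that by (metis G_carrier inv_closed inv_equality inv_inv one_closed plus_closed)
    then show ?thesis
      using that by (intro GI) simp_all
  qed
  show "a \<otimes> b \<in> G" if "a \<in> G" "b \<in> G" for a b
  proof -
    have "a \<otimes> b = a \<otimes> b \<boxplus> lam B a \<one>"
      using mult_plus[of a b \<one>] that by (simp add: lam_def)
    then show ?thesis
      using that by (intro GI) (simp_all add: lam_G_one)
  qed
  show "G \<noteq> {}"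
    using one_G by blast
qed auto

lemma G_inter_E: "x \<in> G \<Longrightarrow> x \<in> E \<Longrightarrow> x = \<one>"
  using G_plus_one[of x] idempotent_plus[of x \<one>] by simp

lemma G_plus_closed: "\<lbrakk>a \<in> G; b \<in> G\<rbrakk> \<Longrightarrow> a \<boxplus> b \<in> G"
  by (intro GI) (simp_all add: plus_assoc)

lemma dot_G:
  assumes "a \<in> carrier B" "b \<in> carrier B" shows "dot B a b \<in> G"
  using assms by (intro GI) (simp_all add: dot_plus_neg plus_assoc)

text \<open>\<open>(B, +)\<close> is a right group: every element is the sum of one of \<open>G\<close> and an idempotent.\<close>

lemma G_plus_E:
  assumes "b \<in> carrier B"
  obtains g e where "g \<in> G" "e \<in> E" "b = g \<boxplus> e"
proof -
  \<comment> \<open>the solution of \<open>(b + \<one>) + e = b\<close>\<close>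
  define e where "e = plus_neg B (b \<boxplus> \<one>) \<boxplus> b"
  have e: "e \<in> carrier B"
    using assms by (simp add: e_def)
  have be: "b \<boxplus> e = b"
    using assms by (simp add: e_def plus_neg_plus_idempotent plus_assoc[symmetric])
  have "e \<boxplus> e = e"
    using assms e be plus_left_cancel[of b "e \<boxplus> e" e] by (simp add: plus_assoc[symmetric])
  then have "e \<in> E"
    using e by (intro idempotentI)
  moreover have "b \<boxplus> \<one> \<in> G"
    using assms by (intro GI) (simp_all add: plus_assoc)
  moreover have "b = (b \<boxplus> \<one>) \<boxplus> e"
    using assms e be by (simp add: plus_assoc)
  ultimately show ?thesis
    using that by blast
qed

lemma inv_brace_part [simp]: "g \<in> G \<Longrightarrow> inv\<^bsub>brace_part B\<^esub> g = inv g"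
  using m_inv_consistent[OF G_subgroup, of g] by (simp flip: brace_part_eq)

lemma plus_neg_brace_part [simp]: "g \<in> G \<Longrightarrow> plus_neg (brace_part B) g = plus_neg B g"
  by (simp add: plus_neg_def lam_def)

lemma dot_brace_part: "\<lbrakk>g \<in> G; h \<in> G\<rbrakk> \<Longrightarrow> dot (brace_part B) g h = dot B g h"
  by (simp add: dot_plus_neg)

lemma brace_part_idem: "brace_part (brace_part B) = brace_part B"
proof -
  have "{b \<boxplus> \<one> | b. b \<in> G} = G"
    using G_plus_one by force
  moreover have "brace_part (brace_part B) = (brace_part B)\<lparr>carrier := {b \<boxplus> \<one> | b. b \<in> G}\<rparr>"
    unfolding brace_part_def[of "brace_part B"] by simp
  ultimately show ?thesis
    by (cases "brace_part B") simp
qed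

end

section \<open>Skew left braces\<close>

text \<open>The inverse of the additive group of a skew left brace.\<close>

abbreviation add_inv :: "'a semi_brace \<Rightarrow> 'a \<Rightarrow> 'a"  ("\<ominus>\<index> _" [81] 80) where
  "\<ominus>\<^bsub>B\<^esub> a \<equiv> inv\<^bsub>additive B\<^esub> a"

text \<open>The same notion as the predicate \<open>skew_left_brace\<close>, as a locale.\<close>

locale skew_brace = left_semi_brace +
  assumes additive_group: "group (additive B)"

sublocale skew_brace \<subseteq> add: group "additive B"
  rewrites "carrier (additive B) = carrier B"
    and "mult (additive B) = plus B"
    and "one (additive B) = one B"
  by (simp_all add: additive_group)

lemma skew_brace_iff: "skew_brace A \<longleftrightarrow> skew_left_brace A"
  by (simp add: skew_brace_def skew_brace_axioms_def skew_left_brace_def)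

lemma (in left_semi_brace) skew_brace_brace_part: "skew_brace (brace_part B)"
proof -
  interpret G: group "brace_part B"
    using subgroup.subgroup_is_group[OF G_subgroup] is_group by (simp flip: brace_part_eq)
  have "left_semi_brace (brace_part B)"
  proof (unfold_locales, goal_cases)
    case (3 a b c)
    then show ?case
      using plus_left_cancel[of a b c] by simp
  next
    case (4 a b c)
    then show ?case
      using mult_plus[of a b c] by simp
  qed (simp_all add: G_plus_closed plus_assoc)
  moreover have "group (additive (brace_part B))"
  proof (rule groupI, goal_cases)
    case (5 a)
    then show ?case
      by (auto intro!: bexI[of _ "plus_neg B a"])
  qed (auto simp: G_plus_closed plus_assoc)
  ultimately show ?thesis
    by (simp add: skew_brace_def skew_brace_axioms_def)
qed

context skew_brace
begin

lemma plus_neg_eq_inv: "a \<in> carrier B \<Longrightarrow> plus_neg B a = \<ominus> a"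
  using add.inv_equality[of "\<ominus> a" a] plus_neg_unique[of a "\<ominus> a"] by simp

lemma G_eq_carrier: "G = carrier B"
  by (auto intro: GI)

lemma brace_part_skew_brace: "brace_part B = B"
  using brace_part_eq[of B] by (simp add: G_eq_carrier)

lemma E_eq_one: "E = {\<one>}"
  using G_inter_E G_eq_carrier one_idempotent idempotent_carrier by blast

lemma dot_eq_lam:
  assumes "a \<in> carrier B" "b \<in> carrier B"
  shows "dot B a b = lam B a b \<boxplus> \<ominus> b"
  using assms by (simp add: dot_plus_neg plus_neg_eq_inv mult_eq_plus_lam add.m_assoc[symmetric])

lemma right_series_Suc:
  "right_series B (Suc n) =
     generate (additive B) {lam B a b \<boxplus> \<ominus> b | a b. a \<in> right_series B n \<and> b \<in> carrier B}"
  (is "_ = generate _ ?Y")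
  if "right_series B n \<subseteq> carrier B"
proof -
  have "{dot B a b | a b. a \<in> right_series B n \<and> b \<in> carrier B} = ?Y"
    using that by (intro Collect_cong ex_cong1) (auto simp: dot_eq_lam)
  moreover have "?Y \<subseteq> carrier B"
    using that by auto
  then have "generate (additive B) ?Y \<subseteq> carrier B"
    using add.generate_incl by simp
  then have "x \<boxplus> \<one> = x" if "x \<in> generate (additive B) ?Y" for x
    using that by auto
  then have "plus_set B (generate (additive B) ?Y) {\<one>} = generate (additive B) ?Y"
    unfolding plus_set_def by force
  ultimately show ?thesis
    by (simp add: dot_set_def brace_part_skew_brace E_eq_one)
qed

text \<open>
  The condition \<open>\<rho>\<^sub>a = \<rho>\<^sub>0\<close> says \<open>a \<circ> b\<^sup>- = b\<^sup>- + a\<close> for all \<open>b\<close>; given \<open>\<lambda>\<^sub>a = \<lambda>\<^sub>0\<close>, this is additive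
  centrality of \<open>a\<close>.
\<close>

lemma socle_iff:
  "a \<in> socle B \<longleftrightarrow>
     a \<in> carrier B \<and> (\<forall>b\<in>carrier B. a \<otimes> b = a \<boxplus> b \<and> a \<boxplus> b = b \<boxplus> a)"
proof (cases "a \<in> carrier B")
  case a: True
  have lam: "lam B a b = lam B \<one> b \<longleftrightarrow> a \<otimes> b = a \<boxplus> b" if "b \<in> carrier B" for b
    using a that plus_left_cancel[of a "lam B a b" b] by (auto simp: mult_eq_plus_lam)
  have rho: "rho B a b = rho B \<one> b \<longleftrightarrow> a \<otimes> inv b = inv b \<boxplus> a" if "b \<in> carrier B" for b
  proof -
    have "rho B a b = rho B \<one> b \<longleftrightarrow> inv (inv b \<boxplus> a) \<otimes> a = b"
      using that by (simp add: rho_def)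
    also have "\<dots> \<longleftrightarrow> a = (inv b \<boxplus> a) \<otimes> b"
      using a that inv_solve_left[of b "inv b \<boxplus> a" a] by auto
    also have "\<dots> \<longleftrightarrow> a \<otimes> inv b = inv b \<boxplus> a"
      using a that inv_solve_right[of "inv b \<boxplus> a" a b] by auto
    finally show ?thesis .
  qed
  show ?thesis
  proof
    assume "a \<in> socle B"
    then have l: "a \<otimes> b = a \<boxplus> b" and r: "a \<otimes> inv b = inv b \<boxplus> a"
      if "b \<in> carrier B" for b
      using that lam rho by (auto simp: socle_def)
    have "a \<boxplus> b = b \<boxplus> a" if "b \<in> carrier B" for b
      using that l[of b] r[of "inv b"] by simp
    then show "a \<in> carrier B \<and> (\<forall>b\<in>carrier B. a \<otimes> b = a \<boxplus> b \<and> a \<boxplus> b = b \<boxplus> a)"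
      using a l by blast
  next
    assume *: "a \<in> carrier B \<and> (\<forall>b\<in>carrier B. a \<otimes> b = a \<boxplus> b \<and> a \<boxplus> b = b \<boxplus> a)"
    then show "a \<in> socle B"
      using lam rho by (simp add: socle_def)
  qed
qed (simp add: socle_def)

lemma socle_carrier [simp]: "a \<in> socle B \<Longrightarrow> a \<in> carrier B"
  using socle_iff by blast

lemma socle_mult: "\<lbrakk>a \<in> socle B; b \<in> carrier B\<rbrakk> \<Longrightarrow> a \<otimes> b = a \<boxplus> b"
  using socle_iff by blast

lemma socle_commute: "\<lbrakk>a \<in> socle B; b \<in> carrier B\<rbrakk> \<Longrightarrow> a \<boxplus> b = b \<boxplus> a"
  using socle_iff by blast

lemma socleI:
  "\<lbrakk>a \<in> carrier B; \<And>b. b \<in> carrier B \<Longrightarrow> a \<otimes> b = a \<boxplus> b;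
    \<And>b. b \<in> carrier B \<Longrightarrow> a \<boxplus> b = b \<boxplus> a\<rbrakk> \<Longrightarrow> a \<in> socle B"
  using socle_iff by blast

lemma socle_subgroup: "subgroup (socle B) B"
proof (rule subgroupI)
  show "socle B \<noteq> {}"
    using socleI[of \<one>] by auto
  show "a \<otimes> c \<in> socle B" if a: "a \<in> socle B" and c: "c \<in> socle B" for a c
  proof (rule socleI)
    fix b assume b: "b \<in> carrier B"
    have "(a \<otimes> c) \<otimes> b = a \<otimes> (c \<otimes> b)"
      using a b c by (simp add: m_assoc)
    also have "\<dots> = (a \<boxplus> c) \<boxplus> b"
      using a b c by (simp add: socle_mult plus_assoc)
    finally show "(a \<otimes> c) \<otimes> b = (a \<otimes> c) \<boxplus> b"
      using a c by (simp add: socle_mult)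
    have "(a \<boxplus> c) \<boxplus> b = a \<boxplus> (b \<boxplus> c)"
      using a b c socle_commute[of c b] by (simp add: plus_assoc)
    also have "\<dots> = b \<boxplus> (a \<boxplus> c)"
      using a b c socle_commute[of a b] by (simp flip: plus_assoc)
    finally show "(a \<otimes> c) \<boxplus> b = b \<boxplus> (a \<otimes> c)"
      using a c by (simp add: socle_mult)
  qed (use a c in simp)
  show "inv a \<in> socle B" if a: "a \<in> socle B" for a
  proof (rule socleI)
    fix b assume b: "b \<in> carrier B"
    have "a \<otimes> \<ominus> a = \<one>"
      using a by (simp add: socle_mult)
    then have inv: "inv a = \<ominus> a"
      using a by (metis add.inv_closed inv_equality inv_inv socle_carrier)
    have "a \<otimes> (\<ominus> a \<boxplus> b) = b"
      using a b by (simp add: socle_mult flip: plus_assoc)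
    then show "inv a \<otimes> b = inv a \<boxplus> b"
      using a b inv_solve_left[of "\<ominus> a \<boxplus> b" a b] by (simp add: inv)
    have "(b \<boxplus> \<ominus> a) = \<ominus> a \<boxplus> (a \<boxplus> b) \<boxplus> \<ominus> a"
      using a b by (simp flip: plus_assoc)
    also have "\<dots> = \<ominus> a \<boxplus> b"
      using a b by (simp add: socle_commute[of a b] plus_assoc)
    finally show "inv a \<boxplus> b = b \<boxplus> inv a"
      by (simp add: inv)
  qed (use a in simp)
qed auto

lemma socle_normal: "socle B \<lhd> B"
proof (unfold normal_inv_iff, intro conjI ballI)
  fix x a assume x: "x \<in> carrier B" and a: "a \<in> socle B"
  let ?c = "x \<otimes> a \<otimes> inv x"
  have c: "?c \<in> carrier B"
    using x a by simp
  have "a \<otimes> inv x = inv x \<boxplus> a"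
    using x a socle_mult[of a "inv x"] socle_commute[of a "inv x"] by simp
  then have c_lam: "?c = lam B x a"
    using x a by (simp add: m_assoc lam_def)
  have commute: "?c \<boxplus> b = b \<boxplus> ?c" if b: "b \<in> carrier B" for b
  proof -
    \<comment> \<open>the preimage of \<open>b\<close> under the additive automorphism \<open>\<lambda>\<^sub>x\<close>, which maps \<open>a\<close> to \<open>c\<close>\<close>
    define d where "d = \<ominus> (inv x) \<boxplus> inv x \<otimes> b"
    have d: "d \<in> carrier B"
      using x b by (simp add: d_def)
    have "inv x \<boxplus> d = inv x \<otimes> b"
      using x b by (simp add: d_def flip: plus_assoc)
    then have "b = lam B x d"
      using x b by (simp add: lam_def flip: m_assoc)
    then show ?thesis
      using x a d socle_commute[of a d] by (simp add: c_lam flip: lam_plus)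
  qed
  show "?c \<in> socle B"
  proof (rule socleI)
    fix b assume b: "b \<in> carrier B"
    have "?c \<otimes> b = x \<otimes> (a \<otimes> (inv x \<otimes> b))"
      using x a b by (simp add: m_assoc)
    also have "\<dots> = x \<otimes> (inv x \<otimes> b \<boxplus> a)"
      using x a b socle_mult[of a "inv x \<otimes> b"] socle_commute[of a "inv x \<otimes> b"] by simp
    also have "\<dots> = x \<otimes> (inv x \<otimes> b) \<boxplus> lam B x a"
      using x a b mult_plus[of x "inv x \<otimes> b" a] by (simp add: lam_def)
    also have "\<dots> = b \<boxplus> ?c"
      using x b by (simp add: c_lam flip: m_assoc)
    finally show "?c \<otimes> b = ?c \<boxplus> b"
      using commute b by simp
  qed (use commute c in auto)
qed (rule socle_subgroup)

end

section \<open>Homomorphisms and the quotient by the socle\<close>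

text \<open>Surjective homomorphisms of skew left braces.\<close>

locale brace_epi = A: skew_brace A + Q: skew_brace Q
  for A :: "'a semi_brace" and Q :: "'b semi_brace" and f :: "'a \<Rightarrow> 'b" +
  assumes surj: "f ` carrier A = carrier Q"
    and hom_mult: "\<lbrakk>x \<in> carrier A; y \<in> carrier A\<rbrakk> \<Longrightarrow> f (x \<otimes>\<^bsub>A\<^esub> y) = f x \<otimes>\<^bsub>Q\<^esub> f y"
    and hom_plus: "\<lbrakk>x \<in> carrier A; y \<in> carrier A\<rbrakk> \<Longrightarrow> f (x \<boxplus>\<^bsub>A\<^esub> y) = f x \<boxplus>\<^bsub>Q\<^esub> f y"
begin

lemma closed [simp]: "x \<in> carrier A \<Longrightarrow> f x \<in> carrier Q"
  using surj by blast

sublocale mult: group_hom A Q f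
  by unfold_locales (auto simp: hom_def hom_mult)

lemma additive_hom: "group_hom (additive A) (additive Q) f"
  using A.additive_group Q.additive_group
  by (auto simp: group_hom_def group_hom_axioms_def hom_def hom_plus)

lemma hom_neg: "x \<in> carrier A \<Longrightarrow> f (\<ominus>\<^bsub>A\<^esub> x) = \<ominus>\<^bsub>Q\<^esub> (f x)"
  using group_hom.hom_inv[OF additive_hom] by simp

lemma hom_lam: "\<lbrakk>x \<in> carrier A; y \<in> carrier A\<rbrakk> \<Longrightarrow> f (lam A x y) = lam Q (f x) (f y)"
  by (simp add: lam_def hom_mult hom_plus)

end

text \<open>A surjective image of a skew left brace is a skew left brace.\<close>

lemma brace_epiI:
  assumes "skew_brace A" and surj: "f ` carrier A = carrier Q"
    and mult: "\<And>x y. \<lbrakk>x \<in> carrier A; y \<in> carrier A\<rbrakk> \<Longrightarrow> f (x \<otimes>\<^bsub>A\<^esub> y) = f x \<otimes>\<^bsub>Q\<^esub> f y"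
    and plus: "\<And>x y. \<lbrakk>x \<in> carrier A; y \<in> carrier A\<rbrakk> \<Longrightarrow> f (x \<boxplus>\<^bsub>A\<^esub> y) = f x \<boxplus>\<^bsub>Q\<^esub> f y"
    and one: "f \<one>\<^bsub>A\<^esub> = \<one>\<^bsub>Q\<^esub>"
  shows "brace_epi A Q f"
proof -
  interpret A: skew_brace A by fact
  have closed [simp]: "f x \<in> carrier Q" if "x \<in> carrier A" for x
    using surj that by blast
  have ex: "\<exists>x\<in>carrier A. z = f x" if "z \<in> carrier Q" for z
    using surj that by blast
  interpret Q: group Q
  proof (rule groupI)
    fix x y z assume xyz: "x \<in> carrier Q" "y \<in> carrier Q" "z \<in> carrier Q"
    then obtain a b c where [simp]: "x = f a" "y = f b" "z = f c"
      and abc: "a \<in> carrier A" "b \<in> carrier A" "c \<in> carrier A"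
      using ex by metis
    show "x \<otimes>\<^bsub>Q\<^esub> y \<otimes>\<^bsub>Q\<^esub> z = x \<otimes>\<^bsub>Q\<^esub> (y \<otimes>\<^bsub>Q\<^esub> z)"
      using abc by (simp add: A.m_assoc flip: mult)
  next
    fix x y assume "x \<in> carrier Q" "y \<in> carrier Q"
    then show "x \<otimes>\<^bsub>Q\<^esub> y \<in> carrier Q"
      using ex by (metis A.m_closed closed mult)
  next
    fix x assume "x \<in> carrier Q"
    then obtain a where a: "a \<in> carrier A" "x = f a"
      using ex by blast
    then show "\<one>\<^bsub>Q\<^esub> \<otimes>\<^bsub>Q\<^esub> x = x"
      by (metis A.l_one A.one_closed mult one)
    show "\<exists>y\<in>carrier Q. y \<otimes>\<^bsub>Q\<^esub> x = \<one>\<^bsub>Q\<^esub>"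
      using a by (metis A.inv_closed A.l_inv closed mult one)
  next
    show "\<one>\<^bsub>Q\<^esub> \<in> carrier Q"
      using closed[of "\<one>\<^bsub>A\<^esub>"] by (simp add: one)
  qed
  have add_group: "group (additive Q)"
  proof (rule groupI; simp)
    fix x y z assume xyz: "x \<in> carrier Q" "y \<in> carrier Q" "z \<in> carrier Q"
    then obtain a b c where [simp]: "x = f a" "y = f b" "z = f c"
      and abc: "a \<in> carrier A" "b \<in> carrier A" "c \<in> carrier A"
      using ex by metis
    show "x \<boxplus>\<^bsub>Q\<^esub> y \<boxplus>\<^bsub>Q\<^esub> z = x \<boxplus>\<^bsub>Q\<^esub> (y \<boxplus>\<^bsub>Q\<^esub> z)"
      using abc by (simp add: A.plus_assoc flip: plus)
  next
    fix x y assume "x \<in> carrier Q" "y \<in> carrier Q"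
    then show "x \<boxplus>\<^bsub>Q\<^esub> y \<in> carrier Q"
      using ex by (metis A.plus_closed closed plus)
  next
    fix x assume "x \<in> carrier Q"
    then obtain a where a: "a \<in> carrier A" "x = f a"
      using ex by blast
    then show "\<one>\<^bsub>Q\<^esub> \<boxplus>\<^bsub>Q\<^esub> x = x"
      by (metis A.one_plus A.one_closed plus one)
    show "\<exists>y\<in>carrier Q. y \<boxplus>\<^bsub>Q\<^esub> x = \<one>\<^bsub>Q\<^esub>"
      using a by (metis A.add.inv_closed A.add.l_inv closed plus one)
  qed
  interpret add: group "additive Q" by (rule add_group)
  have inv: "f (inv\<^bsub>A\<^esub> a) = inv\<^bsub>Q\<^esub> (f a)" if "a \<in> carrier A" for a
    using that by (metis A.inv_closed A.l_inv Q.inv_equality closed mult one)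
  have "left_semi_brace Q"
  proof
    fix x y z assume xyz: "x \<in> carrier Q" "y \<in> carrier Q" "z \<in> carrier Q"
    show "x \<boxplus>\<^bsub>Q\<^esub> y \<in> carrier Q"
      using add.m_closed[of x y] xyz by simp
    show "x \<boxplus>\<^bsub>Q\<^esub> y \<boxplus>\<^bsub>Q\<^esub> z = x \<boxplus>\<^bsub>Q\<^esub> (y \<boxplus>\<^bsub>Q\<^esub> z)"
      using add.m_assoc[of x y z] xyz by simp
    show "x \<boxplus>\<^bsub>Q\<^esub> y = x \<boxplus>\<^bsub>Q\<^esub> z \<Longrightarrow> y = z"
      using add.Units_l_cancel[of x y z] add.Units_eq xyz by simp
    obtain a b c where [simp]: "x = f a" "y = f b" "z = f c"
      and abc: "a \<in> carrier A" "b \<in> carrier A" "c \<in> carrier A"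
      using ex xyz by metis
    show "x \<otimes>\<^bsub>Q\<^esub> (y \<boxplus>\<^bsub>Q\<^esub> z) = (x \<otimes>\<^bsub>Q\<^esub> y) \<boxplus>\<^bsub>Q\<^esub> (x \<otimes>\<^bsub>Q\<^esub> (inv\<^bsub>Q\<^esub> x \<boxplus>\<^bsub>Q\<^esub> z))"
      using abc A.mult_plus[of a b c] by (simp flip: inv mult plus)
  qed
  with add_group have "skew_brace Q"
    by (simp add: skew_brace_def skew_brace_axioms_def)
  with assms show ?thesis
    by (simp add: brace_epi_def brace_epi_axioms_def)
qed

context skew_brace
begin

text \<open>The quotient of \<open>B\<close> by its socle.\<close>

abbreviation Q where "Q \<equiv> quotient_semi_brace B (socle B)"

lemma quotient_plus:
  assumes x: "x \<in> carrier B" and y: "y \<in> carrier B"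
  shows "(socle B #> x) \<boxplus>\<^bsub>Q\<^esub> (socle B #> y) = socle B #> (x \<boxplus> y)"
proof -
  have sub: "socle B \<subseteq> carrier B"
    by auto
  have eq: "socle B #> (x' \<boxplus> y') = socle B #> (x \<boxplus> y)"
    if "x' \<in> socle B #> x" "y' \<in> socle B #> y" for x' y'
  proof -
    obtain s t where s: "s \<in> socle B" "x' = s \<otimes> x" and t: "t \<in> socle B" "y' = t \<otimes> y"
      using \<open>x' \<in> _\<close> \<open>y' \<in> _\<close> by (auto simp: r_coset_def)
    have "x' \<boxplus> y' = s \<boxplus> ((x \<boxplus> t) \<boxplus> y)"
      using s t x y by (simp add: socle_mult plus_assoc)
    also have "x \<boxplus> t = t \<boxplus> x"
      using t x socle_commute[of t x] by simp
    also have "s \<boxplus> ((t \<boxplus> x) \<boxplus> y) = s \<otimes> (t \<otimes> (x \<boxplus> y))"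
      using s t x y by (simp add: socle_mult plus_assoc)
    finally have "x' \<boxplus> y' = (s \<otimes> t) \<otimes> (x \<boxplus> y)"
      using s t x y by (simp add: m_assoc)
    then have "socle B #> (x' \<boxplus> y') = (socle B #> (s \<otimes> t)) #> (x \<boxplus> y)"
      using s t x y sub by (simp add: coset_mult_assoc)
    also have "socle B #> (s \<otimes> t) = socle B"
      using s t socle_subgroup subgroup.m_closed[OF socle_subgroup]
      by (intro coset_join2) auto
    finally show ?thesis .
  qed
  have "x \<in> socle B #> x" "y \<in> socle B #> y"
    using x y rcos_self[OF _ socle_subgroup] by auto
  then have "(\<Union>x'\<in>socle B #> x. \<Union>y'\<in>socle B #> y. socle B #> (x' \<boxplus> y'))
      = socle B #> (x \<boxplus> y)"
    using eq by blast
  then show ?thesis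
    by (simp add: quotient_semi_brace_def)
qed

lemma quotient_epi: "brace_epi B Q (\<lambda>x. socle B #> x)"
proof (rule brace_epiI)
  interpret normal "socle B" B
    by (rule socle_normal)
  show "skew_brace B"
    by unfold_locales
  show "(\<lambda>x. socle B #> x) ` carrier B = carrier Q"
    by (auto simp: quotient_semi_brace_def FactGroup_def RCOSETS_def)
  show "socle B #> (x \<otimes> y) = (socle B #> x) \<otimes>\<^bsub>Q\<^esub> (socle B #> y)"
    if "x \<in> carrier B" "y \<in> carrier B" for x y
    using that by (simp add: quotient_semi_brace_def FactGroup_def rcos_sum)
  show "socle B #> \<one> = \<one>\<^bsub>Q\<^esub>"
    by (simp add: quotient_semi_brace_def FactGroup_def coset_mult_one subset)
qed (simp add: quotient_plus)

lemma quotient_kernel: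
  assumes "x \<in> carrier B"
  shows "socle B #> x = \<one>\<^bsub>Q\<^esub> \<longleftrightarrow> x \<in> socle B"
  using assms coset_join1[OF _ _ socle_subgroup, of x] coset_join2[OF _ socle_subgroup, of x]
  by (auto simp: quotient_semi_brace_def FactGroup_def)

end

text \<open>
  The quotient by the socle can be transported to a set of coset representatives, so that it has
  a copy with the element type of \<open>B\<close>.
\<close>

lemma (in skew_brace) quotient_copy:
  "\<exists>T :: 'a semi_brace. skew_left_brace T \<and> semi_brace_isomorphic T Q"
proof -
  interpret q: brace_epi B Q "\<lambda>x. socle B #> x"
    by (rule quotient_epi)
  define p where "p = (\<lambda>x. socle B #> x)"
  define r where "r = inv_into (carrier B) p"
  define T :: "'a semi_brace" where
    "T = \<lparr>carrier = r ` carrier Q, mult = (\<lambda>x y. r (p x \<otimes>\<^bsub>Q\<^esub> p y)), one = r \<one>\<^bsub>Q\<^esub>,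
          plus = (\<lambda>x y. r (p x \<boxplus>\<^bsub>Q\<^esub> p y))\<rparr>"
  have p_r: "p (r X) = X" if "X \<in> carrier Q" for X
    using that q.surj f_inv_into_f[of X p "carrier B"] by (simp add: r_def p_def)
  have "brace_epi Q T r"
  proof (rule brace_epiI)
    show "skew_brace Q"
      by unfold_locales
  qed (simp_all add: T_def p_r)
  then have T: "skew_left_brace T"
    by (simp add: brace_epi_def skew_brace_iff)
  have bij: "bij_betw p (carrier T) (carrier Q)"
    by (rule bij_betw_byWitness[of _ r]) (auto simp: T_def p_r)
  have "p \<in> iso T Q" "p \<in> iso (additive T) (additive Q)"
    using bij by (auto simp: iso_def hom_def) (auto simp: T_def p_r)
  with T show ?thesis
    unfolding semi_brace_isomorphic_def by blast
qed

section \<open>The ascending socle series\<close>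

text \<open>
  The preimages in \<open>A\<close> of the zero elements of the successive quotients by the socle, described
  inside \<open>A\<close>: the defining conditions say that the image of \<open>a\<close> in the \<open>n\<close>-th quotient lies in
  the socle.
\<close>

primrec socle_series :: "'a semi_brace \<Rightarrow> nat \<Rightarrow> 'a set" where
  "socle_series A 0 = {\<one>\<^bsub>A\<^esub>}"
| "socle_series A (Suc n) = {a \<in> carrier A. \<forall>b\<in>carrier A.
     lam A a b \<boxplus>\<^bsub>A\<^esub> \<ominus>\<^bsub>A\<^esub> b \<in> socle_series A n \<and>
     a \<boxplus>\<^bsub>A\<^esub> b \<boxplus>\<^bsub>A\<^esub> \<ominus>\<^bsub>A\<^esub> a \<boxplus>\<^bsub>A\<^esub> \<ominus>\<^bsub>A\<^esub> b \<in> socle_series A n}"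

text \<open>
  The sequence of iterated quotients by the socle, indexed from one and determined only up to
  isomorphism.
\<close>

definition socle_sequence :: "'a semi_brace \<Rightarrow> (nat \<Rightarrow> 'a semi_brace) \<Rightarrow> bool" where
  "socle_sequence A S \<longleftrightarrow> S 1 = A \<and>
     (\<forall>n\<ge>1. skew_left_brace (S n) \<and>
        semi_brace_isomorphic (S (Suc n)) (quotient_semi_brace (S n) (socle (S n))))"

lemma ex_socle_sequence:
  assumes "skew_left_brace (A :: 'a semi_brace)"
  obtains S where "socle_sequence A S"
proof -
  define P where "P C T \<longleftrightarrow> skew_left_brace T \<and>
    semi_brace_isomorphic T (quotient_semi_brace C (socle C))" for C T :: "'a semi_brace"
  have P: "P C (SOME T. P C T)" if "skew_left_brace C" for C
  proof -
    have "\<exists>T. P C T"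
      using skew_brace.quotient_copy[of C] that unfolding P_def skew_brace_iff by blast
    then show ?thesis
      by (rule someI_ex)
  qed
  define S where "S n = ((\<lambda>C. SOME T. P C T) ^^ (n - 1)) A" for n
  have S_Suc: "S (Suc n) = (SOME T. P (S n) T)" if "n \<ge> 1" for n
    using that by (cases n) (auto simp: S_def)
  have S: "skew_left_brace (S n)" if "n \<ge> 1" for n
    using that
  proof (induction n rule: dec_induct)
    case base
    then show ?case using assms by (simp add: S_def)
  next
    case (step n)
    then show ?case
      using P[of "S n"] S_Suc[of n] unfolding P_def by metis
  qed
  have "P (S n) (S (Suc n))" if "n \<ge> 1" for n
    using P[OF S] S_Suc that by simp
  then have "socle_sequence A S"
    using S unfolding socle_sequence_def P_def by (simp add: S_def)
  then show ?thesis
    using that by blast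
qed

lemma (in skew_brace) mem_socle_iff:
  assumes a: "a \<in> carrier B"
  shows "a \<in> socle B \<longleftrightarrow> (\<forall>b\<in>carrier B. lam B a b \<boxplus> \<ominus> b = \<one> \<and> a \<boxplus> b \<boxplus> \<ominus> a \<boxplus> \<ominus> b = \<one>)"
proof -
  have "lam B a b \<boxplus> \<ominus> b = \<one> \<longleftrightarrow> a \<otimes> b = a \<boxplus> b" if b: "b \<in> carrier B" for b
  proof -
    have "lam B a b \<boxplus> \<ominus> b = \<one> \<longleftrightarrow> lam B a b = b"
      using a b add.inv_solve_right'[of \<one> "lam B a b" b] by simp
    also have "\<dots> \<longleftrightarrow> a \<otimes> b = a \<boxplus> b"
      using a b plus_left_cancel[of a "lam B a b" b] mult_eq_plus_lam[of a b]
        lam_closed[of a b] by metis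
    finally show ?thesis .
  qed
  moreover have "a \<boxplus> b \<boxplus> \<ominus> a \<boxplus> \<ominus> b = \<one> \<longleftrightarrow> a \<boxplus> b = b \<boxplus> a" if b: "b \<in> carrier B" for b
  proof -
    have "a \<boxplus> b \<boxplus> \<ominus> a \<boxplus> \<ominus> b = \<one> \<longleftrightarrow> a \<boxplus> b \<boxplus> \<ominus> a = b"
      using a b add.inv_solve_right'[of \<one> "a \<boxplus> b \<boxplus> \<ominus> a" b] by simp
    also have "\<dots> \<longleftrightarrow> a \<boxplus> b = b \<boxplus> a"
      using a b add.inv_solve_right'[of b "a \<boxplus> b" a] by simp
    finally show ?thesis .
  qed
  ultimately show ?thesis
    using a unfolding socle_iff by blast
qed

text \<open>
  If the socle series has reached the kernel of \<open>f\<close>, then its next term is the preimage of the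
  socle of the image.
\<close>

lemma (in brace_epi) mem_socle_series_Suc:
  assumes ker: "\<And>x. x \<in> carrier A \<Longrightarrow> f x = \<one>\<^bsub>Q\<^esub> \<longleftrightarrow> x \<in> socle_series A n"
    and a: "a \<in> carrier A"
  shows "a \<in> socle_series A (Suc n) \<longleftrightarrow> f a \<in> socle Q"
proof -
  have "f a \<in> socle Q \<longleftrightarrow> (\<forall>b\<in>carrier A.
      lam Q (f a) (f b) \<boxplus>\<^bsub>Q\<^esub> \<ominus>\<^bsub>Q\<^esub> (f b) = \<one>\<^bsub>Q\<^esub> \<and>
      f a \<boxplus>\<^bsub>Q\<^esub> f b \<boxplus>\<^bsub>Q\<^esub> \<ominus>\<^bsub>Q\<^esub> (f a) \<boxplus>\<^bsub>Q\<^esub> \<ominus>\<^bsub>Q\<^esub> (f b) = \<one>\<^bsub>Q\<^esub>)"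
    using a by (simp add: Q.mem_socle_iff flip: surj)
  also have "\<dots> \<longleftrightarrow> a \<in> socle_series A (Suc n)"
    using a by (simp add: hom_plus hom_neg hom_lam flip: ker)
  finally show ?thesis ..
qed

lemma socle_series_kernel_step:
  assumes "brace_epi A S f"
    and ker: "\<And>x. x \<in> carrier A \<Longrightarrow> f x = \<one>\<^bsub>S\<^esub> \<longleftrightarrow> x \<in> socle_series A n"
    and T: "skew_brace T" and iso: "semi_brace_isomorphic T (quotient_semi_brace S (socle S))"
  obtains h where "brace_epi A T h"
    "\<And>x. x \<in> carrier A \<Longrightarrow> h x = \<one>\<^bsub>T\<^esub> \<longleftrightarrow> x \<in> socle_series A (Suc n)"
proof -
  interpret f: brace_epi A S f by fact
  interpret T: skew_brace T by fact
  let ?Q = "quotient_semi_brace S (socle S)"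
  define p where "p = (\<lambda>x. socle S #>\<^bsub>S\<^esub> x)"
  interpret q: brace_epi S ?Q p
    unfolding p_def by (rule f.Q.quotient_epi)
  obtain g where g: "g \<in> iso T ?Q" "g \<in> iso (additive T) (additive ?Q)"
    using iso by (auto simp: semi_brace_isomorphic_def)
  have bij: "bij_betw g (carrier T) (carrier ?Q)"
    and g_mult: "\<And>x y. \<lbrakk>x \<in> carrier T; y \<in> carrier T\<rbrakk> \<Longrightarrow> g (x \<otimes>\<^bsub>T\<^esub> y) = g x \<otimes>\<^bsub>?Q\<^esub> g y"
    and g_plus: "\<And>x y. \<lbrakk>x \<in> carrier T; y \<in> carrier T\<rbrakk> \<Longrightarrow> g (x \<boxplus>\<^bsub>T\<^esub> y) = g x \<boxplus>\<^bsub>?Q\<^esub> g y"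
    using g by (auto simp: iso_def hom_def)
  have inj: "x = y" if "g x = g y" "x \<in> carrier T" "y \<in> carrier T" for x y
    using bij that by (auto simp: bij_betw_def inj_on_def)
  interpret g: group_hom T ?Q g
    by unfold_locales (use g in \<open>simp add: iso_def\<close>)
  define h where "h x = inv_into (carrier T) g (p (f x))" for x
  have h: "h x \<in> carrier T" "g (h x) = p (f x)" if "x \<in> carrier A" for x
    using that bij f_inv_into_f[of "p (f x)" g "carrier T"]
      inv_into_into[of "p (f x)" g "carrier T"]
    by (auto simp: h_def bij_betw_def)
  have "brace_epi A T h"
  proof (intro brace_epi.intro brace_epi_axioms.intro)
    show "h ` carrier A = carrier T"
    proof (intro equalityI subsetI)
      fix z assume z: "z \<in> carrier T"
      then obtain x where "x \<in> carrier A" "g z = p (f x)"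
        using q.surj f.surj g.hom_closed[of z] by (metis imageE)
      then show "z \<in> h ` carrier A"
        using z h[of x] inj[of "h x" z] by auto
    qed (use h in auto)
    show "h (x \<otimes>\<^bsub>A\<^esub> y) = h x \<otimes>\<^bsub>T\<^esub> h y" if "x \<in> carrier A" "y \<in> carrier A" for x y
      by (rule inj) (use that in \<open>simp_all add: h g_mult f.hom_mult q.hom_mult\<close>)
    show "h (x \<boxplus>\<^bsub>A\<^esub> y) = h x \<boxplus>\<^bsub>T\<^esub> h y" if "x \<in> carrier A" "y \<in> carrier A" for x y
      by (rule inj) (use that in \<open>simp_all add: h g_plus f.hom_plus q.hom_plus\<close>)
  qed unfold_locales
  moreover have "h x = \<one>\<^bsub>T\<^esub> \<longleftrightarrow> x \<in> socle_series A (Suc n)" if x: "x \<in> carrier A" for x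
  proof -
    have "h x = \<one>\<^bsub>T\<^esub> \<longleftrightarrow> p (f x) = \<one>\<^bsub>?Q\<^esub>"
      using x h[of x] inj[of "h x" "\<one>\<^bsub>T\<^esub>"] by auto
    also have "\<dots> \<longleftrightarrow> f x \<in> socle S"
      using x f.Q.quotient_kernel[of "f x"] by (simp add: p_def)
    finally show ?thesis
      using f.mem_socle_series_Suc[OF ker x] by simp
  qed
  ultimately show ?thesis
    using that by blast
qed

lemma socle_sequence_kernel:
  assumes S: "socle_sequence A S"
  obtains f where "brace_epi A (S (Suc n)) f"
    "\<And>x. x \<in> carrier A \<Longrightarrow> f x = \<one>\<^bsub>S (Suc n)\<^esub> \<longleftrightarrow> x \<in> socle_series A n"
proof -
  have sb: "skew_brace (S (Suc m))" for m
    using S by (simp add: socle_sequence_def skew_brace_iff)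
  have "\<exists>f. brace_epi A (S (Suc n)) f \<and>
    (\<forall>x\<in>carrier A. f x = \<one>\<^bsub>S (Suc n)\<^esub> \<longleftrightarrow> x \<in> socle_series A n)"
  proof (induction n)
    case 0
    have "S (Suc 0) = A" "skew_brace A"
      using S sb[of 0] by (simp_all add: socle_sequence_def)
    then show ?case
      by (intro exI[of _ id]) (simp add: brace_epi_def brace_epi_axioms_def)
  next
    case (Suc n)
    then obtain f where f: "brace_epi A (S (Suc n)) f"
      "\<And>x. x \<in> carrier A \<Longrightarrow> f x = \<one>\<^bsub>S (Suc n)\<^esub> \<longleftrightarrow> x \<in> socle_series A n"
      by blast
    have "semi_brace_isomorphic (S (Suc (Suc n)))
        (quotient_semi_brace (S (Suc n)) (socle (S (Suc n))))"
      using S by (simp add: socle_sequence_def)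
    from socle_series_kernel_step[OF f sb this] show ?case
      by metis
  qed
  then show ?thesis
    using that by blast
qed

lemma finite_multipermutational_level_iff:
  assumes A: "skew_left_brace A"
  shows "finite_multipermutational_level A \<longleftrightarrow> (\<exists>n. socle_series A n = carrier A)"
proof -
  have trivial: "carrier (S (Suc n)) = {\<one>\<^bsub>S (Suc n)\<^esub>} \<longleftrightarrow> socle_series A n = carrier A"
    if S: "socle_sequence A S" for S n
  proof -
    obtain f where "brace_epi A (S (Suc n)) f"
      and ker: "\<And>x. x \<in> carrier A \<Longrightarrow> f x = \<one>\<^bsub>S (Suc n)\<^esub> \<longleftrightarrow> x \<in> socle_series A n"
      using socle_sequence_kernel[OF S, of n] by blast
    then interpret f: brace_epi A "S (Suc n)" f
      by simp
    have "socle_series A n \<subseteq> carrier A"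
      by (cases n) auto
    then have "socle_series A n = carrier A \<longleftrightarrow> (\<forall>x\<in>carrier A. f x = \<one>\<^bsub>S (Suc n)\<^esub>)"
      using ker by blast
    also have "\<dots> \<longleftrightarrow> f ` carrier A = {\<one>\<^bsub>S (Suc n)\<^esub>}"
      using f.A.one_closed by (intro iffI) (force, blast)
    also have "\<dots> \<longleftrightarrow> carrier (S (Suc n)) = {\<one>\<^bsub>S (Suc n)\<^esub>}"
      by (simp add: f.surj)
    finally show ?thesis ..
  qed
  have "finite_multipermutational_level A \<longleftrightarrow>
      (\<exists>S. socle_sequence A S \<and> (\<exists>n\<ge>1. carrier (S n) = {\<one>\<^bsub>S n\<^esub>}))"
    by (simp add: finite_multipermutational_level_def socle_sequence_def conj_assoc)
  also have "\<dots> \<longleftrightarrow> (\<exists>S. socle_sequence A S \<and> (\<exists>n. carrier (S (Suc n)) = {\<one>\<^bsub>S (Suc n)\<^esub>}))"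
    by (metis One_nat_def Suc_le_D le_add1 plus_1_eq_Suc)
  also have "\<dots> \<longleftrightarrow> (\<exists>n. socle_series A n = carrier A)"
    using trivial ex_socle_sequence[OF A] by metis
  finally show ?thesis .
qed

context skew_brace
begin

text \<open>
  This is not evident from the recursive description; it holds because each term is the kernel of
  a homomorphism.
\<close>

lemma socle_series_subgroup: "subgroup (socle_series B n) (additive B)"
proof -
  have "skew_left_brace B"
    using skew_brace_axioms skew_brace_iff by blast
  then obtain S where S: "socle_sequence B S"
    by (rule ex_socle_sequence)
  obtain f where "brace_epi B (S (Suc n)) f"
    and ker: "\<And>x. x \<in> carrier B \<Longrightarrow> f x = \<one>\<^bsub>S (Suc n)\<^esub> \<longleftrightarrow> x \<in> socle_series B n"
    using socle_sequence_kernel[OF S, of n] by blast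
  then interpret f: brace_epi B "S (Suc n)" f
    by simp
  have "socle_series B n \<subseteq> carrier B"
    by (cases n) auto
  then have "kernel (additive B) (additive (S (Suc n))) f = socle_series B n"
    using ker by (auto simp: kernel_def)
  then show ?thesis
    using group_hom.subgroup_kernel[OF f.additive_hom] by simp
qed

lemma socle_series_mono:
  assumes "m \<le> n" shows "socle_series B m \<subseteq> socle_series B n"
proof -
  have one: "\<one> \<in> socle_series B n" for n
    using subgroup.one_closed[OF socle_series_subgroup] by simp
  have "socle_series B n \<subseteq> socle_series B (Suc n)" for n
  proof (induction n)
    case 0
    then show ?case
      by simp
  qed auto
  then show ?thesis
    using assms by (rule lift_Suc_mono_le)
qed

lemma right_series_subset: "right_series B n \<subseteq> carrier B"
proof (induction n)
  case (Suc n)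
  then show ?case
    unfolding right_series_Suc[OF Suc] by (intro add.generate_incl[simplified]) auto
qed simp

lemma right_series_subgroup: "subgroup (right_series B n) (additive B)"
proof (cases n)
  case 0
  then show ?thesis
    using add.subgroup_self by simp
next
  case (Suc m)
  have "{lam B a b \<boxplus> \<ominus> b | a b. a \<in> right_series B m \<and> b \<in> carrier B} \<subseteq> carrier B"
    using right_series_subset[of m] by auto
  then show ?thesis
    unfolding Suc right_series_Suc[OF right_series_subset] by (intro add.generate_is_subgroup) simp
qed

lemma neg_plus_cancel: "\<lbrakk>a \<in> carrier B; b \<in> carrier B\<rbrakk> \<Longrightarrow> \<ominus> a \<boxplus> (a \<boxplus> b) = b"
  by (simp flip: plus_assoc)

text \<open>
  Normality holds for the subgroup generated by all \<open>a * b = \<lambda>\<^sub>a(b) - b\<close> with \<open>a\<close> in any subset,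
  because \<open>c + (a * b) - c = -(a * c) + a * (c + b)\<close>.
\<close>

lemma right_series_conjugate:
  assumes x: "x \<in> right_series B n" and c: "c \<in> carrier B"
  shows "c \<boxplus> x \<boxplus> \<ominus> c \<in> right_series B n"
proof (cases n)
  case 0
  then show ?thesis
    using x c by simp
next
  case (Suc m)
  define Y where "Y = {lam B a b \<boxplus> \<ominus> b | a b. a \<in> right_series B m \<and> b \<in> carrier B}"
  have Y: "Y \<subseteq> carrier B"
    using right_series_subset[of m] by (auto simp: Y_def)
  have n: "right_series B n = generate (additive B) Y"
    unfolding Suc right_series_Suc[OF right_series_subset] Y_def ..
  have closed: "x \<boxplus> y \<in> generate (additive B) Y" "\<ominus> x \<in> generate (additive B) Y"
    if "x \<in> generate (additive B) Y" "y \<in> generate (additive B) Y" for x y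
    using that right_series_subgroup[of n] subgroup.m_closed[of _ "additive B" x y]
      subgroup.m_inv_closed[of _ "additive B" x] by (simp_all add: n)
  have carrier: "x \<in> carrier B" if "x \<in> generate (additive B) Y" for x
    using that right_series_subset[of n] n by blast
  have gen: "c \<boxplus> y \<boxplus> \<ominus> c \<in> generate (additive B) Y" if y: "y \<in> Y" for y
  proof -
    obtain a b where ab: "y = lam B a b \<boxplus> \<ominus> b" "a \<in> right_series B m" "b \<in> carrier B"
      using y by (auto simp: Y_def)
    then have a: "a \<in> carrier B"
      using right_series_subset by blast
    \<comment> \<open>the conjugate is \<open>-(a * c) + a * (c + b)\<close>\<close>
    have "lam B a c \<boxplus> \<ominus> c \<in> Y" "lam B a (c \<boxplus> b) \<boxplus> \<ominus> (c \<boxplus> b) \<in> Y"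
      using ab c unfolding Y_def by blast+
    then have "\<ominus> (lam B a c \<boxplus> \<ominus> c) \<boxplus> (lam B a (c \<boxplus> b) \<boxplus> \<ominus> (c \<boxplus> b)) \<in> generate (additive B) Y"
      by (intro closed generate.incl) auto
    also have "\<ominus> (lam B a c \<boxplus> \<ominus> c) \<boxplus> (lam B a (c \<boxplus> b) \<boxplus> \<ominus> (c \<boxplus> b)) = c \<boxplus> y \<boxplus> \<ominus> c"
      using a ab c by (simp add: lam_plus add.inv_mult_group plus_assoc neg_plus_cancel)
    finally show ?thesis .
  qed
  have "c \<boxplus> x \<boxplus> \<ominus> c \<in> generate (additive B) Y"
    using x unfolding n
  proof (induction x rule: generate.induct)
    case one
    then show ?case
      using c generate.one[of "additive B" Y] by simp
  next
    case (incl h)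
    then show ?case
      by (rule gen)
  next
    case (inv h)
    then have "\<ominus> (c \<boxplus> h \<boxplus> \<ominus> c) \<in> generate (additive B) Y"
      using gen closed by blast
    then show ?case
      using inv Y c by (simp add: add.inv_mult_group plus_assoc subset_iff)
  next
    case (eng h1 h2)
    have "(c \<boxplus> h1 \<boxplus> \<ominus> c) \<boxplus> (c \<boxplus> h2 \<boxplus> \<ominus> c) \<in> generate (additive B) Y"
      using eng.IH by (rule closed)
    also have "(c \<boxplus> h1 \<boxplus> \<ominus> c) \<boxplus> (c \<boxplus> h2 \<boxplus> \<ominus> c) = c \<boxplus> (h1 \<boxplus> h2) \<boxplus> \<ominus> c"
      using eng.hyps[THEN carrier] c by (simp add: plus_assoc neg_plus_cancel)
    finally show ?case
      by simp
  qed
  then show ?thesis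
    by (simp add: n)
qed

section \<open>Finite multipermutational level of skew left braces\<close>

lemma lam_in_right_series_Suc:
  assumes "a \<in> right_series B n" "b \<in> carrier B"
  shows "lam B a b \<boxplus> \<ominus> b \<in> right_series B (Suc n)"
  unfolding right_series_Suc[OF right_series_subset] using assms by (auto intro!: generate.incl)

lemma commutator_in_lower_central_series_Suc:
  assumes "a \<in> lower_central_series (additive B) n" "b \<in> carrier B"
  shows "a \<boxplus> b \<boxplus> \<ominus> a \<boxplus> \<ominus> b \<in> lower_central_series (additive B) (Suc n)"
  using assms by (auto intro!: generate.incl)

lemma right_series_le_socle_series:
  assumes k: "socle_series B k = carrier B" and "j \<le> k"
  shows "right_series B j \<subseteq> socle_series B (k - j)"
  using \<open>j \<le> k\<close>
proof (induction j)
  case (Suc j)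
  have "k - j = Suc (k - Suc j)"
    using Suc.prems by simp
  then have "right_series B j \<subseteq> socle_series B (Suc (k - Suc j))"
    using Suc by simp
  then have "{lam B a b \<boxplus> \<ominus> b | a b. a \<in> right_series B j \<and> b \<in> carrier B}
      \<subseteq> socle_series B (k - Suc j)"
    by auto
  then show ?case
    unfolding right_series_Suc[OF right_series_subset]
    by (rule add.generate_subgroup_incl) (rule socle_series_subgroup)
qed (simp add: k)

lemma lower_central_series_le_socle_series:
  assumes k: "socle_series B k = carrier B" and "j \<le> k"
  shows "lower_central_series (additive B) j \<subseteq> socle_series B (k - j)"
  using \<open>j \<le> k\<close>
proof (induction j)
  case (Suc j)
  have "k - j = Suc (k - Suc j)"
    using Suc.prems by simp
  then have "lower_central_series (additive B) j \<subseteq> socle_series B (Suc (k - Suc j))"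
    using Suc by simp
  then have "{a \<boxplus> b \<boxplus> \<ominus> a \<boxplus> \<ominus> b | a b.
      a \<in> lower_central_series (additive B) j \<and> b \<in> carrier B} \<subseteq> socle_series B (k - Suc j)"
    by auto
  then show ?case
    using add.generate_subgroup_incl[OF _ socle_series_subgroup] by simp
qed (simp add: k)

text \<open>
  Normality of \<open>right_series B m\<close> keeps the commutators \<open>a + b - a - b\<close> in it, while they move one
  step down the lower central series; the elements \<open>\<lambda>\<^sub>a(b) - b\<close> are in the next term of the right
  series, hence already in \<open>socle_series B k\<close>.
\<close>

lemma right_series_inter_lower_central_series:
  assumes c: "lower_central_series (additive B) c = {\<one>}"
    and m: "right_series B (Suc m) \<subseteq> socle_series B k" and "j \<le> c"
  shows "right_series B m \<inter> lower_central_series (additive B) (c - j) \<subseteq> socle_series B (k + j)"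
  using \<open>j \<le> c\<close>
proof (induction j)
  case 0
  then show ?case
    using c subgroup.one_closed[OF socle_series_subgroup] by auto
next
  case (Suc j)
  show ?case
  proof
    fix a assume a: "a \<in> right_series B m \<inter> lower_central_series (additive B) (c - Suc j)"
    then have a_carrier: "a \<in> carrier B"
      using right_series_subset by blast
    have "lam B a b \<boxplus> \<ominus> b \<in> socle_series B (k + j) \<and>
        a \<boxplus> b \<boxplus> \<ominus> a \<boxplus> \<ominus> b \<in> socle_series B (k + j)" if b: "b \<in> carrier B" for b
    proof
      show "lam B a b \<boxplus> \<ominus> b \<in> socle_series B (k + j)"
        using a b m lam_in_right_series_Suc[of a m b] socle_series_mono[of k "k + j"] by auto
      have "\<ominus> a \<in> right_series B m"
        using a subgroup.m_inv_closed[OF right_series_subgroup] by blast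
      then have "b \<boxplus> \<ominus> a \<boxplus> \<ominus> b \<in> right_series B m"
        using b by (rule right_series_conjugate)
      then have "a \<boxplus> (b \<boxplus> \<ominus> a \<boxplus> \<ominus> b) \<in> right_series B m"
        using a subgroup.m_closed[OF right_series_subgroup] by fastforce
      then have "a \<boxplus> b \<boxplus> \<ominus> a \<boxplus> \<ominus> b \<in> right_series B m"
        using a_carrier b by (simp add: plus_assoc)
      moreover have "Suc (c - Suc j) = c - j"
        using Suc.prems by simp
      then have "a \<boxplus> b \<boxplus> \<ominus> a \<boxplus> \<ominus> b \<in> lower_central_series (additive B) (c - j)"
        using a b commutator_in_lower_central_series_Suc[of a "c - Suc j" b] by simp
      ultimately show "a \<boxplus> b \<boxplus> \<ominus> a \<boxplus> \<ominus> b \<in> socle_series B (k + j)"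
        using Suc by auto
    qed
    then show "a \<in> socle_series B (k + Suc j)"
      using a_carrier by simp
  qed
qed

theorem finite_multipermutational_level_iff_nilpotent:
  "finite_multipermutational_level B \<longleftrightarrow> right_nilpotent B \<and> nilpotent_group (additive B)"
proof -
  have "skew_left_brace B"
    using skew_brace_axioms skew_brace_iff by blast
  then have "finite_multipermutational_level B \<longleftrightarrow> (\<exists>k. socle_series B k = carrier B)"
    by (rule finite_multipermutational_level_iff)
  also have "\<dots> \<longleftrightarrow> right_nilpotent B \<and> nilpotent_group (additive B)"
  proof
    assume "\<exists>k. socle_series B k = carrier B"
    then obtain k where k: "socle_series B k = carrier B"
      by blast
    have "right_series B k = {\<one>}"
      using right_series_le_socle_series[OF k, of k] subgroup.one_closed[OF right_series_subgroup]
      by auto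
    moreover have "\<one> \<in> lower_central_series (additive B) k"
      using generate.one[of "additive B"] by (cases k) simp_all
    then have "lower_central_series (additive B) k = {\<one>}"
      using lower_central_series_le_socle_series[OF k, of k] by auto
    ultimately show "right_nilpotent B \<and> nilpotent_group (additive B)"
      using additive_group by (auto simp: right_nilpotent_def nilpotent_group_def E_eq_one)
  next
    assume "right_nilpotent B \<and> nilpotent_group (additive B)"
    then obtain n c where n: "right_series B n = {\<one>}"
      and c: "lower_central_series (additive B) c = {\<one>}"
      by (auto simp: right_nilpotent_def nilpotent_group_def E_eq_one)
    have "right_series B (n - i) \<subseteq> socle_series B (i * c)" if "i \<le> n" for i
      using that
    proof (induction i)
      case (Suc i)
      have "Suc (n - Suc i) = n - i"
        using Suc.prems by simp
      then have "right_series B (Suc (n - Suc i)) \<subseteq> socle_series B (i * c)"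
        using Suc by simp
      from right_series_inter_lower_central_series[OF c this, of c]
      have "right_series B (n - Suc i) \<inter> carrier B \<subseteq> socle_series B (i * c + c)"
        by simp
      then show ?case
        using right_series_subset by (simp add: Int_absorb2 add.commute)
    qed (simp add: n)
    from this[of n] have "carrier B \<subseteq> socle_series B (n * c)"
      by simp
    then show "\<exists>k. socle_series B k = carrier B"
      using subgroup.subset[OF socle_series_subgroup] by fastforce
  qed
  finally show ?thesis .
qed

end

section \<open>Reduction of left semi-braces to skew left braces\<close>

context left_semi_brace
begin

lemma idempotents_ideal_iff: "semi_brace_ideal E B \<longleftrightarrow> E \<lhd> B"
proof
  assume E: "E \<lhd> B"
  interpret G: skew_brace "brace_part B"
    by (rule skew_brace_brace_part)
  have "E \<inter> G = {\<one>}"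
    using G_inter_E by auto
  moreover have "{\<one>} \<lhd> additive (brace_part B)"
    using group.one_is_normal[OF G.additive_group] by simp
  moreover have "rho B b \<one> = \<one>" if "b \<in> carrier B" for b
    using that by (simp add: rho_def)
  moreover have "E \<subseteq> carrier B"
    by auto
  ultimately show "semi_brace_ideal E B"
    using E unfolding semi_brace_ideal_def by simp
qed (simp add: semi_brace_ideal_def)

lemma dot_set_subset_G:
  assumes "X \<subseteq> carrier B"
  shows "dot_set B X (carrier B) \<subseteq> G"
proof -
  interpret G: skew_brace "brace_part B"
    by (rule skew_brace_brace_part)
  show ?thesis
    unfolding dot_set_def using assms dot_G by (intro G.add.generate_incl) auto
qed

lemma right_series_Suc_subset: "right_series B (Suc n) \<subseteq> right_series B n"
proof (induction n)
  case 0
  have "x \<in> carrier B" if "x \<in> dot_set B (carrier B) (carrier B)" for x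
    using dot_set_subset_G[of "carrier B"] that by auto
  then show ?case
    by (auto simp: plus_set_def)
next
  case (Suc n)
  interpret G: skew_brace "brace_part B"
    by (rule skew_brace_brace_part)
  have "dot_set B (right_series B (Suc n)) (carrier B) \<subseteq> dot_set B (right_series B n) (carrier B)"
    unfolding dot_set_def by (rule G.add.mono_generate) (use Suc in blast)
  then show ?case
    unfolding right_series.simps(2)[of B "Suc n"] right_series.simps(2)[of B n]
    by (auto simp: plus_set_def simp del: right_series.simps)
qed

lemma right_nilpotent_imp_normal:
  assumes "right_nilpotent B" shows "E \<lhd> B"
proof -
  obtain n where n: "right_series B n = E"
    using assms by (auto simp: right_nilpotent_def)
  have conj: "inv h \<otimes> e \<otimes> h \<in> E" if e: "e \<in> E" and h: "h \<in> G" for e h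
  proof -
    have "dot B e h \<in> dot_set B E (carrier B)"
      using e G_carrier[OF h] unfolding dot_set_def by (intro generate.incl) blast
    then have "dot B e h \<boxplus> \<one> \<in> right_series B (Suc n)"
      using one_idempotent unfolding right_series.simps n plus_set_def by blast
    then have "dot B e h \<in> E"
      using right_series_Suc_subset[of n] n dot_G[of e h] e h by auto
    then have dot: "dot B e h = \<one>"
      using dot_G[of e h] e h G_inter_E by auto
    have "plus_neg B e = \<one>"
      using e plus_neg_plus_idempotent[of \<one> e] plus_neg_unique[of \<one> \<one>] by simp
    then have "e \<otimes> h \<boxplus> plus_neg B h = \<one>"
      using dot e h by (simp add: dot_plus_neg)
    then have "e \<otimes> h \<boxplus> plus_neg B h \<boxplus> h = h"
      using h by simp
    then have "e \<otimes> h \<boxplus> \<one> = h"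
      using e h by (simp add: plus_assoc)
    then have eh: "e \<otimes> h \<otimes> lam B (inv (e \<otimes> h)) \<one> = h"
      using e h by (simp add: plus_eq_mult_lam)
    \<comment> \<open>\<open>e \<circ> h\<close> and \<open>h = e \<circ> h + \<one>\<close> differ by an idempotent on the right\<close>
    define f where "f = lam B (inv (e \<otimes> h)) \<one>"
    have f: "f \<in> E"
      using e h by (simp add: f_def)
    have "e \<otimes> h = h \<otimes> inv f"
      using eh e h f inv_solve_right[of "e \<otimes> h" h f] by (simp add: f_def)
    then have "inv h \<otimes> e \<otimes> h = inv f"
      using e h f by (simp add: m_assoc) (simp flip: m_assoc)
    then show ?thesis
      using f by simp
  qed
  show ?thesis
  proof (unfold normal_inv_iff, intro conjI ballI)
    fix x e assume x: "x \<in> carrier B" and e: "e \<in> E"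
    obtain g f where gf: "g \<in> G" "f \<in> E" "inv x = g \<boxplus> f"
      using G_plus_E[of "inv x"] x by auto
    define f' where "f' = lam B (inv g) f"
    have f': "f' \<in> E" and x': "inv x = g \<otimes> f'"
      using gf by (simp_all add: f'_def plus_eq_mult_lam)
    have "x = inv f' \<otimes> inv g"
      using x x' f' gf inv_inv[of x] by (simp add: inv_mult_group)
    then have "x \<otimes> e \<otimes> inv x = inv f' \<otimes> (inv g \<otimes> e \<otimes> g) \<otimes> f'"
      using x x' f' gf e by (simp add: m_assoc)
    also have "\<dots> \<in> E"
      using conj[OF e \<open>g \<in> G\<close>] f' subgroup.m_closed[OF idempotents_subgroup] by simp
    finally show "x \<otimes> e \<otimes> inv x \<in> E" .
  qed (rule idempotents_subgroup)
qed

text \<open>If \<open>E\<close> is normal, then idempotent summands do not affect the operation \<open>\<cdot>\<close>.\<close>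

lemma dot_plus_idempotents:
  assumes E: "E \<lhd> B" and g: "g \<in> G" and e: "e \<in> E" and h: "h \<in> G" and f: "f \<in> E"
  shows "dot B (g \<boxplus> e) (h \<boxplus> f) = dot B g h"
proof -
  define e' where "e' = lam B (inv g) e"
  define f' where "f' = lam B (inv h) f"
  have e': "e' \<in> E" "g \<boxplus> e = g \<otimes> e'" and f': "f' \<in> E" "h \<boxplus> f = h \<otimes> f'"
    using assms by (simp_all add: e'_def f'_def plus_eq_mult_lam)
  \<comment> \<open>normality moves \<open>e'\<close> to the right of \<open>h\<close>\<close>
  define d where "d = inv h \<otimes> e' \<otimes> h \<otimes> f'"
  have d: "d \<in> E"
    using normal.inv_op_closed1[OF E, of h e'] e' f' h subgroup.m_closed[OF idempotents_subgroup]
    by (simp add: d_def)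
  have "h \<otimes> d = e' \<otimes> h \<otimes> f'"
    using h e' f' by (simp add: d_def flip: m_assoc)
  then have "(g \<boxplus> e) \<otimes> (h \<boxplus> f) = g \<otimes> h \<otimes> d"
    using g h e' f' d by (simp add: m_assoc)
  also have "\<dots> = g \<otimes> h \<boxplus> lam B (g \<otimes> h) d"
    using g h d by (simp add: mult_eq_plus_lam)
  finally have "dot B (g \<boxplus> e) (h \<boxplus> f) =
      plus_neg B g \<boxplus> ((g \<otimes> h \<boxplus> lam B (g \<otimes> h) d) \<boxplus> plus_neg B h)"
    using g h e f d by (simp add: dot_plus_neg plus_neg_plus_idempotent plus_assoc)
  also have "\<dots> = plus_neg B g \<boxplus> (g \<otimes> h \<boxplus> plus_neg B h)"
    using g h d plus_idempotent_plus[of "g \<otimes> h" "lam B (g \<otimes> h) d" "plus_neg B h"] by simp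
  also have "\<dots> = dot B g h"
    using g h by (simp add: dot_plus_neg plus_assoc)
  finally show ?thesis .
qed

lemma right_series_eq_plus_idempotents:
  assumes E: "E \<lhd> B"
  shows "right_series B n = plus_set B (right_series (brace_part B) n) E"
proof (induction n)
  case 0
  have "x \<in> plus_set B G E" if "x \<in> carrier B" for x
    using G_plus_E[OF that] unfolding plus_set_def by blast
  moreover have "plus_set B G E \<subseteq> carrier B"
    by (auto simp: plus_set_def)
  ultimately show ?case
    unfolding right_series.simps by blast
next
  case (Suc n)
  interpret G: skew_brace "brace_part B"
    by (rule skew_brace_brace_part)
  let ?R = "right_series (brace_part B) n"
  have R: "?R \<subseteq> G"
    by (rule G.right_series_subset)
  have "{dot B x y | x y. x \<in> right_series B n \<and> y \<in> carrier B} =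
      {dot (brace_part B) g h | g h. g \<in> ?R \<and> h \<in> G}" (is "?L = ?M")
  proof
    show "?L \<subseteq> ?M"
    proof
      fix z assume "z \<in> ?L"
      then obtain x y where z: "z = dot B x y" "x \<in> right_series B n" "y \<in> carrier B"
        by blast
      obtain g e where g: "g \<in> ?R" "e \<in> E" "x = g \<boxplus> e"
        using z(2) unfolding Suc plus_set_def by blast
      obtain h f where h: "h \<in> G" "f \<in> E" "y = h \<boxplus> f"
        using G_plus_E z(3) by blast
      have "z = dot (brace_part B) g h"
        using z g h R E by (simp add: dot_plus_idempotents dot_brace_part subset_iff)
      then show "z \<in> ?M"
        using g h by blast
    qed
    show "?M \<subseteq> ?L"
    proof
      fix z assume "z \<in> ?M"
      then obtain g h where z: "z = dot (brace_part B) g h" "g \<in> ?R" "h \<in> G"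
        by blast
      then have "g \<in> G"
        using R by blast
      then have "g = g \<boxplus> \<one>"
        by simp
      then have "g \<in> right_series B n"
        using z one_idempotent unfolding Suc plus_set_def by blast
      then show "z \<in> ?L"
        using z \<open>g \<in> G\<close> dot_brace_part[of g h] G_carrier[of h] by blast
    qed
  qed
  then have "dot_set B (right_series B n) (carrier B) = dot_set (brace_part B) ?R G"
    by (simp add: dot_set_def brace_part_idem)
  moreover have "right_series (brace_part B) (Suc n) = dot_set (brace_part B) ?R G"
  proof -
    have "x \<boxplus> \<one> = x" if "x \<in> dot_set (brace_part B) ?R G" for x
      using G.dot_set_subset_G[of ?R] R that G_plus_one[of x]
      by (auto simp: G.G_eq_carrier)
    then show ?thesis
      unfolding right_series.simps plus_set_def G.E_eq_one by force
  qed
  ultimately show ?case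
    unfolding right_series.simps(2)[of B] by simp
qed

lemma right_nilpotent_iff_brace_part:
  assumes E: "E \<lhd> B"
  shows "right_nilpotent B \<longleftrightarrow> right_nilpotent (brace_part B)"
proof -
  interpret G: skew_brace "brace_part B"
    by (rule skew_brace_brace_part)
  have "plus_set B R E = E \<longleftrightarrow> R = {\<one>}" if R: "R \<subseteq> G" "\<one> \<in> R" for R
  proof
    assume *: "plus_set B R E = E"
    have "x = \<one>" if "x \<in> R" for x
    proof -
      have "x \<boxplus> \<one> \<in> E"
        using that * one_idempotent unfolding plus_set_def by blast
      then show ?thesis
        using that R G_inter_E[of x] by (auto simp: subset_iff)
    qed
    then show "R = {\<one>}"
      using R by blast
  next
    assume "R = {\<one>}"
    then show "plus_set B R E = E"
      by (force simp: plus_set_def)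
  qed
  moreover have "right_series (brace_part B) n \<subseteq> G" "\<one> \<in> right_series (brace_part B) n" for n
    using G.right_series_subset subgroup.one_closed[OF G.right_series_subgroup[of n]] by simp_all
  ultimately show ?thesis
    unfolding right_nilpotent_def right_series_eq_plus_idempotents[OF E] G.E_eq_one by simp
qed

end

theorem theorem36:
  fixes B :: "'a semi_brace"
  assumes "left_semi_brace B"
  shows "(finite_multipermutational_level (brace_part B) \<and>
            semi_brace_ideal (plus_idempotents B) B) \<longleftrightarrow>
         (right_nilpotent B \<and> nilpotent_group (additive (brace_part B)))"
proof -
  interpret left_semi_brace B by fact
  interpret G: skew_brace "brace_part B"
    by (rule skew_brace_brace_part)
  show ?thesis
    unfolding idempotents_ideal_iff G.finite_multipermutational_level_iff_nilpotent
    using right_nilpotent_imp_normal right_nilpotent_iff_brace_part by blast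
qed

end
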